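(* Let $w$ be a finite word and $p\ge 1$ an integer. If $w$ is a palindrome which is periodic with period $p$ and $|w| \ge 2p$, then $w$ is a palindromic periodicity with period $p$.
   Context: A word $w=w[1\dots n]$ is a finite sequence of letters; $|w|=n$ is its length. $w$ has period $p$ if $w[i]=w[i+p]$ for all $i$ such that both $w[i]$ and $w[i+p]$ are in $w$. A word is a palindrome if it equals its reverse; the empty word $\epsilon$ is a palindrome. For a nonempty word $x$, $x^\omega=xxx\cdots$ is the infinite concatenation of $x$ with itself. A factor is a contiguous block. A word $w$ is a palindromic periodicity with period $q$ (where $q\ge 1$ is an integer) if there are palindromes $u$ and $s$ (either of which may be empty) with $|us|=q$ such that $w$ is a factor of $(us)^\omega$ and $|w|\ge q$. *)

theory Defs
  imports Main "HOL-Library.Omega_Words_Fun"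
begin

text \<open>
  Finite words are lists, indexed from 0. Infinite words, their factors
  \<open>x [i \<rightarrow> j]\<close> (positions \<open>i, \<dots>, j - 1\<close>) and the infinite power \<open>x\<^sup>\<omega>\<close> of a
  nonempty word are those of \<open>Omega_Words_Fun\<close>, whose type synonym \<open>word\<close> denotes infinite words.
\<close>

definition has_period :: "'a list \<Rightarrow> nat \<Rightarrow> bool" where
  "has_period w p \<longleftrightarrow> (\<forall>i. i + p < length w \<longrightarrow> w ! i = w ! (i + p))"

definition palindrome :: "'a list \<Rightarrow> bool" where
  "palindrome w \<longleftrightarrow> rev w = w"

definition factor_of :: "'a list \<Rightarrow> 'a word \<Rightarrow> bool" where
  "factor_of w x \<longleftrightarrow> (\<exists>i j. w = x [i \<rightarrow> j])"

text \<open>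
  The condition \<open>1 \<le> q\<close> makes \<open>u @ s\<close> nonempty, so that \<open>(u @ s)\<^sup>\<omega>\<close> is meaningful
  (the library leaves \<open>[]\<^sup>\<omega>\<close> unspecified).
\<close>

definition palindromic_periodicity :: "'a list \<Rightarrow> nat \<Rightarrow> bool" where
  "palindromic_periodicity w q \<longleftrightarrow>
     1 \<le> q \<and>
     (\<exists>u s. palindrome u \<and> palindrome s \<and> length (u @ s) = q \<and>
            factor_of w ((u @ s)\<^sup>\<omega>) \<and> q \<le> length w)"

end

theory Submission
  imports Defs "HOL-Number_Theory.Cong"
begin

text \<open>
  Write \<open>n = |w|\<close>. The period \<open>p\<close> makes the letter of \<open>w\<close> at a position depend only on the residue
  of the position modulo \<open>p\<close>, and the palindrome property identifies the letters at \<open>i\<close> and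
  \<open>n - 1 - i\<close>. Hence two positions \<open>i, j\<close> with \<open>i + j + 1 \<equiv> n\<close> modulo \<open>p\<close> carry the same letter
  (\<open>palindrome_period_reflect\<close>): the reflection of \<open>w\<close> descends to a reflection of the residues
  modulo \<open>p\<close>. Put \<open>r = n mod p\<close>. On \<open>{0..<p}\<close> this reflection maps \<open>{0..<r}\<close> to itself by
  \<open>i \<mapsto> r - 1 - i\<close> and \<open>{r..<p}\<close> to itself by \<open>i \<mapsto> p + r - 1 - i\<close>. The prefix of length \<open>p\<close>
  therefore splits after \<open>r\<close> letters into two palindromes \<open>u\<close> and \<open>s\<close>, and \<open>w\<close> is the prefix of
  length \<open>n\<close> of \<open>(us)\<^sup>\<omega>\<close>.
\<close>

lemma has_period_nth_mod:
  assumes "has_period w p" and "i < length w"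
  shows "w ! i = w ! (i mod p)"
  using assms(2)
proof (induction i rule: less_induct)
  case (less i)
  show ?case
  proof (cases "p = 0 \<or> i < p")
    case True
    then show ?thesis by auto
  next
    case False
    then have "w ! (i - p) = w ! i"
      using assms(1) less.prems unfolding has_period_def
      by (auto dest: spec[of _ "i - p"])
    moreover have "w ! (i - p) = w ! ((i - p) mod p)"
      using less False by auto
    ultimately show ?thesis
      using False by (simp add: le_mod_geq)
  qed
qed

lemma palindrome_nth:
  assumes "palindrome w" and "i < length w"
  shows "w ! i = w ! (length w - 1 - i)"
  using assms rev_nth[of i w] by (simp add: palindrome_def)

lemma palindromeI:
  assumes "\<And>i. i < length w \<Longrightarrow> w ! i = w ! (length w - 1 - i)"
  shows "palindrome w"
  unfolding palindrome_def
proof (rule nth_equalityI)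
  fix i assume "i < length (rev w)"
  then show "rev w ! i = w ! i"
    using assms[of i] by (simp add: rev_nth)
qed simp

text \<open>
  Reflecting \<open>i\<close> in \<open>w\<close> gives \<open>|w| - 1 - i\<close>, which is congruent to \<open>j\<close> modulo the period.
\<close>

lemma palindrome_period_reflect:
  assumes "palindrome w" and "has_period w p"
    and i: "i < length w" and j: "j < length w"
    and cong: "(i + j + 1) mod p = length w mod p"
  shows "w ! i = w ! j"
proof -
  let ?k = "length w - 1 - i"
  have "i + j + 1 = (i + 1) + j" and "length w = (i + 1) + ?k"
    using i by simp_all
  with cong have "[(i + 1) + j = (i + 1) + ?k] (mod p)"
    unfolding cong_def by metis
  then have "j mod p = ?k mod p"
    unfolding cong_add_lcancel_nat by (simp only: cong_def)
  moreover have "w ! i = w ! ?k"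
    by (rule palindrome_nth[OF assms(1) i])
  ultimately show ?thesis
    using has_period_nth_mod[OF assms(2), of j] has_period_nth_mod[OF assms(2), of ?k] i j by simp
qed

lemma has_period_factor_of_prefix_power:
  assumes "has_period w p" and "1 \<le> p" and "p \<le> length w"
  shows "factor_of w ((take p w)\<^sup>\<omega>)"
proof -
  have "w = (take p w)\<^sup>\<omega> [0 \<rightarrow> length w]"
  proof (rule nth_equalityI)
    fix i assume i: "i < length w"
    have "0 < p" and "w \<noteq> []" and "min (length w) p = p" and "i mod p < p"
      using assms i by auto
    then show "w ! i = ((take p w)\<^sup>\<omega> [0 \<rightarrow> length w]) ! i"
      using has_period_nth_mod[OF assms(1) i] i by simp
  qed simp
  then show ?thesis unfolding factor_of_def by blast
qed

theorem theorem2p1: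
  fixes w :: "'a list" and p :: nat
  assumes "1 \<le> p"
    and "palindrome w"
    and "has_period w p"
    and "2 * p \<le> length w"
  shows "palindromic_periodicity w p"
proof -
  define r where "r = length w mod p"
  define u where "u = take r w"
  define s where "s = drop r (take p w)"
  have r: "r < p" and p: "p \<le> length w"
    using assms(1,4) by (auto simp: r_def)
  have us: "u @ s = take p w"
    using r append_take_drop_id[of r "take p w"] by (simp add: u_def s_def min_def)
  \<comment> \<open>The sum of two positions below \<open>p\<close> that mirror each other modulo \<open>p\<close> is \<open>r - 1\<close> within \<open>u\<close>
    and \<open>p + r - 1\<close> within \<open>s\<close>, whose letters start at position \<open>r\<close>.\<close>
  have reflect: "w ! i = w ! j"
    if "i < p" "j < p" "i + j + 1 = r \<or> i + j + 1 = p + r" for i j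
  proof (rule palindrome_period_reflect[OF assms(2,3)])
    show "(i + j + 1) mod p = length w mod p"
      using that(3) r unfolding r_def by (elim disjE) simp_all
  qed (use that p in auto)
  have "palindrome u"
  proof (rule palindromeI)
    fix i assume "i < length u"
    then show "u ! i = u ! (length u - 1 - i)"
      using reflect[of i "r - 1 - i"] r p by (simp add: u_def)
  qed
  moreover have "palindrome s"
  proof (rule palindromeI)
    fix i assume "i < length s"
    then show "s ! i = s ! (length s - 1 - i)"
      using reflect[of "r + i" "p - 1 - i"] r p by (simp add: s_def)
  qed
  moreover have "factor_of w ((u @ s)\<^sup>\<omega>)"
    unfolding us by (rule has_period_factor_of_prefix_power[OF assms(3,1) p])
  moreover have "length (u @ s) = p"
    using us p by simp
  ultimately show ?thesis
    using assms(1) p unfolding palindromic_periodicity_def by blast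
qed

end
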